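(* Consider the optimization problem in the decision variables $\overline{U}\in\mathbb{R}^{Nn_u}$ and $\mathbf{K}\in\mathcal{K}$: minimize $J_{\mathrm{ub}}(\overline{U},\mathbf{K})=\sum_{k=0}^{N-1}\big[\|\overline{u}_k\|_2+m_{\chi^2}(0.01,n_u)\,\|P_{u_k}^{1/2}\|_2\big]$ (impulsive control), or $J_{\mathrm{ub}}(\overline{U},\mathbf{K})=\sum_{k=0}^{N-1}\big[\|\overline{u}_k\|_2+m_{\chi^2}(0.01,n_u)\,\|P_{u_k}^{1/2}\|_2\big]\Delta t_k$ (continuous control), subject to (i) $a_j^\top\overline{x}_k+b_j+m_{\mathcal N}(\varepsilon_{x,j})\,\|a_j^\top P_k^{1/2}\|_2\le 0$ for all $j$ and all $k\in\{0,\dots,N\}$; (ii) $\|H(\overline{x}_k-x_k^* )\|_2+m_{\chi^2}(\varepsilon_x,n_h)\,\|HP_k^{1/2}\|_2\le d_{\max}$ for all $k\in\{0,\dots,N\}$; (iii) $\|\overline{u}_k\|_2+m_{\chi^2}(\varepsilon_u,n_u)\,\|P_{u_k}^{1/2}\|_2\le u_{\max}$ for all $k\in\{0,\dots,N-1\}$; (iv) $\|(E_{u_{k+1}}-E_{u_k})\overline{U}\|_2+m_{\chi^2}(\varepsilon_u,n_u)\,\|(E_{u_{k+1}}-E_{u_k})\mathbf{K}\mathbf{S}^{1/2}\|_2\le\Delta u_{\max}$ for all $k\in\{0,\dots,N-2\}$; (v) $E_{x_N}(\mathbf{A}\overline{x}_0+\mathbf{B}\overline{U}+\mathbf{C})-x_f=0$;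 (vi) $\|(P_f-\widetilde{P}_N)^{-1/2}E_{x_N}(I+\mathbf{B}\mathbf{K})\mathbf{S}^{1/2}\|_2-1\le 0$. Here $\overline{u}_k=E_{u_k}\overline{U}$, $\overline{x}_k=E_{x_k}(\mathbf{A}\overline{x}_0+\mathbf{B}\overline{U}+\mathbf{C})$, $P_k^{1/2}=\big[\,E_{x_k}(I+\mathbf{B}\mathbf{K})\mathbf{S}^{1/2}\;\;\widetilde{P}_k^{1/2}\,\big]$, and $P_{u_k}^{1/2}=E_{u_k}\mathbf{K}\mathbf{S}^{1/2}$. Then this problem is a convex optimization problem.
   Context: "Convex optimization problem" means: minimize a convex function of the decision variables over a set given by finitely many inequalities (convex function) $\le 0$ and affine equalities. For a vector $\|\cdot\|_2$ is the Euclidean norm; for a matrix it is the spectral norm. Fixed data: integers $N,n_x,n_u,n_y,n_h\ge 1$; matrices $A_k\in\mathbb{R}^{n_x\times n_x}$, $B_k\in\mathbb{R}^{n_x\times n_u}$, $G_{\mathrm{exe},k}$, $G_k$ (with $n_x$ rows) and vectors $c_k\in\mathbb{R}^{n_x}$ for $k=0,\dots,N-1$; matrices $C_k\in\mathbb{R}^{n_y\times n_x}$, $D_k\in\mathbb{R}^{n_y\times n_y}$ for $k=0,\dots,N$; $\overline{x}_0\in\mathbb{R}^{n_x}$; positive semidefinite $\hat P_{0^-},\widetilde P_0^-\in\mathbb{R}^{n_x\times n_x}$. Kalman filter quantities are computed a priori by $P_{\widetilde y_k^-}=C_k\widetilde P_k^-C_k^\top+D_kD_k^\top$ (assumed invertible),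 $L_k=\widetilde P_k^-C_k^\top P_{\widetilde y_k^-}^{-1}$, $\widetilde P_k=(I-L_kC_k)\widetilde P_k^-(I-L_kC_k)^\top+L_kD_kD_k^\top L_k^\top$ for $k=0,\dots,N$, and $\widetilde P_{k}^-=A_{k-1}\widetilde P_{k-1}A_{k-1}^\top+G_{\mathrm{exe},k-1}G_{\mathrm{exe},k-1}^\top+G_{k-1}G_{k-1}^\top$ for $k\ge1$. For a positive semidefinite $M$, $M^{1/2}$ denotes a lower-triangular matrix with $M=M^{1/2}(M^{1/2})^\top$, and $M^{-1/2}=(M^{1/2})^{-1}$ if $M\succ0$. With $\Phi(k,j)=A_{k-1}A_{k-2}\cdots A_j$ for $k>j$ and $\Phi(j,j)=I$, define block matrices with block rows $k=0,\dots,N$: $\mathbf A$ has block rows $\Phi(k,0)$; $\mathbf B$ has blocks $(k,j)$, $j=0,\dots,N-1$, equal to $\Phi(k,j+1)B_j$ if $j<k$ and $0$ otherwise; $\mathbf C$ has block rows $\sum_{j<k}\Phi(k,j+1)c_j$; $\mathbf L$ has blocks $(k,j)$, $j=0,\dots,N$, equal to $\Phi(k,j)L_j$ if $j\le k$ and $0$ otherwise. Let $\mathbf P_Y=\mathrm{blkdiag}(P_{\widetilde y_0^-},\dots,P_{\widetilde y_N^-})$ and $\mathbf S^{1/2}=\big[\mathbf A\hat P_{0^-}^{1/2}\;\;\mathbf L\mathbf P_Y^{1/2}\big]$ (so $\mathbf S^{1/2}(\mathbf S^{1/2})^\top=\mathbf S:=\mathbf A\hat P_{0^-}\mathbf A^\top+\mathbf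 L\mathbf P_Y\mathbf L^\top$). $E_{x_k}$ ($k=0,\dots,N$) extracts the $k$-th $n_x$-block from a vector in $\mathbb{R}^{(N+1)n_x}$; $E_{u_k}$ ($k=0,\dots,N-1$) extracts the $k$-th $n_u$-block from a vector in $\mathbb{R}^{Nn_u}$. $\mathcal K$ is the linear space of matrices $\mathbf K\in\mathbb{R}^{Nn_u\times(N+1)n_x}$ of the form $\mathbf K=[\mathrm{blkdiag}(K_0,\dots,K_{N-1})\;\;0]$ with $K_k\in\mathbb{R}^{n_u\times n_x}$ (last block column zero). $m_{\mathcal N}(\varepsilon)$ is the $(1-\varepsilon)$-quantile of the standard normal distribution; $m_{\chi^2}(\varepsilon,n)$ is the square root of the $(1-\varepsilon)$-quantile of the chi-squared distribution with $n$ degrees of freedom. Constraint data: finitely many $a_j\in\mathbb{R}^{n_x}$, $b_j\in\mathbb{R}$; $\varepsilon_x\in(0,0.5)$, $\varepsilon_u\in(0,1)$; fixed $\varepsilon_{x,j}>0$ with $\sum_j\varepsilon_{x,j}\le\varepsilon_x$; $H\in\mathbb{R}^{n_h\times n_x}$; reference states $x_k^*\in\mathbb{R}^{n_x}$; $d_{\max},u_{\max},\Delta u_{\max}>0$; $\Delta t_k>0$; $x_f\in\mathbb{R}^{n_x}$; $P_f\in\mathbb{R}^{n_x\times n_x}$ symmetric with $P_f-\widetilde P_N\succ0$. *)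

theory Defs
  imports "HOL-Analysis.Analysis" "HOL-Probability.Probability"
begin

subsection \<open>Convex optimization problems\<close>

record ('v, 'w) opt_problem =
  decisions :: "'v set"
  objective :: "'v \<Rightarrow> real"
  inequalities :: "('v \<Rightarrow> real) set"
  equalities :: "('v \<Rightarrow> 'w) set"

text \<open>The problem is to minimize the objective over the feasible set. Vector-valued equality
  constraints are allowed; one of them stands for finitely many scalar ones.\<close>

definition feasible_set :: "('v, 'w::zero) opt_problem \<Rightarrow> 'v set" where
  "feasible_set P = {v \<in> decisions P.
     (\<forall>g \<in> inequalities P. g v \<le> 0) \<and> (\<forall>h \<in> equalities P. h v = 0)}"

definition affine_map_on :: "'v::real_vector set \<Rightarrow> ('v \<Rightarrow> 'w::real_vector) \<Rightarrow> bool" where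
  "affine_map_on X h \<longleftrightarrow> (\<exists>f c. linear f \<and> (\<forall>v\<in>X. h v = f v + c))"

definition convex_opt_problem :: "('v::real_vector, 'w::real_vector) opt_problem \<Rightarrow> bool" where
  "convex_opt_problem P \<longleftrightarrow>
     subspace (decisions P) \<and>
     convex_on (decisions P) (objective P) \<and>
     finite (inequalities P) \<and> (\<forall>g \<in> inequalities P. convex_on (decisions P) g) \<and>
     finite (equalities P) \<and> (\<forall>h \<in> equalities P. affine_map_on (decisions P) h)"


subsection \<open>Quantiles\<close>

definition quantile :: "real measure \<Rightarrow> real \<Rightarrow> real" where
  "quantile M p = Inf {x. p \<le> cdf M x}"

definition chi_squared_distribution :: "nat \<Rightarrow> real measure" where
  "chi_squared_distribution n =
     distr (Pi\<^sub>M {..<n} (\<lambda>_. std_normal_distribution)) borel (\<lambda>z. \<Sum>i<n. (z i)\<^sup>2)"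

definition m_normal :: "real \<Rightarrow> real" where
  "m_normal \<epsilon> = quantile std_normal_distribution (1 - \<epsilon>)"

definition m_chi :: "real \<Rightarrow> nat \<Rightarrow> real" where
  "m_chi \<epsilon> n = sqrt (quantile (chi_squared_distribution n) (1 - \<epsilon>))"


subsection \<open>Matrices\<close>

definition psd :: "real^'a^'a \<Rightarrow> bool" where
  "psd M \<longleftrightarrow> transpose M = M \<and> (\<forall>v. 0 \<le> v \<bullet> (M *v v))"

definition pos_def :: "real^'a^'a \<Rightarrow> bool" where
  "pos_def M \<longleftrightarrow> transpose M = M \<and> (\<forall>v. v \<noteq> 0 \<longrightarrow> 0 < v \<bullet> (M *v v))"

definition spectral_norm :: "real^'b^'a \<Rightarrow> real" where
  "spectral_norm M = onorm ((*v) M)"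

definition hcat :: "real^'b^'a \<Rightarrow> real^'c^'a \<Rightarrow> real^('b + 'c)^'a" where
  "hcat M M' = (\<chi> r c. case c of Inl b \<Rightarrow> M $ r $ b | Inr b \<Rightarrow> M' $ r $ b)"

text \<open>\<open>lower_factor before M R\<close> means that \<open>R\<close> is a lower-triangular square root
  of \<open>M\<close>, the index type being strictly ordered by \<open>before\<close>. Such an \<open>R\<close>
  need not be unique.\<close>

definition lower_factor :: "('a \<Rightarrow> 'a \<Rightarrow> bool) \<Rightarrow> real^'a^'a \<Rightarrow> real^'a^'a \<Rightarrow> bool" where
  "lower_factor before M R \<longleftrightarrow>
     (\<forall>r c. before r c \<longrightarrow> R $ r $ c = 0) \<and> R ** transpose R = M"


subsection \<open>Block vectors and block matrices\<close>

text \<open>The index type \<open>'n fin\<close> consists of the numbers below \<open>CARD('n)\<close>.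
  With horizon \<open>N = CARD('n)\<close>, the control steps \<open>0, \<dots>, N - 1\<close> are
  \<open>'n fin\<close> and the stages \<open>0, \<dots>, N\<close> are \<open>'n option fin\<close>, because
  \<open>CARD('n option) = N + 1\<close>. A vector of \<open>CARD('n)\<close> blocks indexed by
  \<open>'a\<close> has the index type \<open>'n fin \<times> 'a\<close>.\<close>

typedef 'n fin = "{..<CARD('n::finite)}"
  morphisms idx of_idx
  by (intro exI[of _ 0]) simp

instance fin :: (finite) finite
proof
  show "finite (UNIV :: 'a fin set)"
    unfolding type_definition.univ [OF type_definition_fin] by simp
qed

definition block_less :: "'n::finite fin \<times> 'a::linorder \<Rightarrow> 'n fin \<times> 'a \<Rightarrow> bool" where
  "block_less p q \<longleftrightarrow>
     idx (fst p) < idx (fst q) \<or> (idx (fst p) = idx (fst q) \<and> snd p < snd q)"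

definition block_vec :: "(nat \<Rightarrow> real^'a) \<Rightarrow> real^('p::finite fin \<times> 'a)" where
  "block_vec v = (\<chi> r. v (idx (fst r)) $ snd r)"

definition block_col :: "(nat \<Rightarrow> real^'b^'a) \<Rightarrow> real^'b^('p::finite fin \<times> 'a)" where
  "block_col M = (\<chi> r c. M (idx (fst r)) $ snd r $ c)"

definition block_mat ::
  "(nat \<Rightarrow> nat \<Rightarrow> real^'b^'a) \<Rightarrow> real^('q::finite fin \<times> 'b)^('p::finite fin \<times> 'a)" where
  "block_mat M = (\<chi> r c. M (idx (fst r)) (idx (fst c)) $ snd r $ snd c)"

text \<open>For a non-square block pattern the superfluous blocks are zero.\<close>

definition blkdiag :: "(nat \<Rightarrow> real^'b^'a) \<Rightarrow> real^('q::finite fin \<times> 'b)^('p::finite fin \<times> 'a)" where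
  "blkdiag M = block_mat (\<lambda>k j. if k = j then M k else 0)"

text \<open>The matrix extracting the \<open>k\<close>-th block of a block vector.\<close>

definition E_block :: "nat \<Rightarrow> real^('p::finite fin \<times> 'a)^'a" where
  "E_block k = (\<chi> r c. if idx (fst c) = k \<and> snd c = r then 1 else 0)"


subsection \<open>Concatenated dynamics\<close>

text \<open>\<open>Phi A k j\<close> is \<open>A (k-1) ** \<dots> ** A j\<close> for \<open>j < k\<close>; the values for
  \<open>k < j\<close> are never used.\<close>

primrec Phi :: "(nat \<Rightarrow> real^'a^'a) \<Rightarrow> nat \<Rightarrow> nat \<Rightarrow> real^'a^'a" where
  "Phi A 0 j = mat 1"
| "Phi A (Suc k) j = (if j \<le> k then A k ** Phi A k j else mat 1)"

definition bigA :: "(nat \<Rightarrow> real^'x^'x) \<Rightarrow> real^'x^('n::finite option fin \<times> 'x)" where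
  "bigA A = block_col (\<lambda>k. Phi A k 0)"

definition bigB :: "(nat \<Rightarrow> real^'x^'x) \<Rightarrow> (nat \<Rightarrow> real^'u^'x)
    \<Rightarrow> real^('n::finite fin \<times> 'u)^('n option fin \<times> 'x)" where
  "bigB A B = block_mat (\<lambda>k j. if j < k then Phi A k (j + 1) ** B j else 0)"

definition bigC :: "(nat \<Rightarrow> real^'x^'x) \<Rightarrow> (nat \<Rightarrow> real^'x)
    \<Rightarrow> real^('n::finite option fin \<times> 'x)" where
  "bigC A c = block_vec (\<lambda>k. \<Sum>j<k. Phi A k (j + 1) *v c j)"

definition bigL :: "(nat \<Rightarrow> real^'x^'x) \<Rightarrow> (nat \<Rightarrow> real^'y^'x)
    \<Rightarrow> real^('n::finite option fin \<times> 'y)^('n option fin \<times> 'x)" where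
  "bigL A L = block_mat (\<lambda>k j. if j \<le> k then Phi A k j ** L j else 0)"

text \<open>The gains \<open>[blkdiag (K\<^sub>0, \<dots>, K\<^sub>N\<^sub>-\<^sub>1)  0]\<close>: there are \<open>N\<close> block rows and
  \<open>N + 1\<close> block columns, so the last block column of \<open>blkdiag\<close> vanishes.\<close>

definition gain_space :: "(real^('n::finite option fin \<times> 'x::finite)^('n fin \<times> 'u::finite)) set" where
  "gain_space = range blkdiag"

end

theory Submission
  imports Defs
begin

text \<open>
  Up to an additive constant, every inequality constraint and every stage cost is a sum of an
  affine function, or the norm of an affine map, and a multiple \<open>m\<close> of the norm of an affine map,
  where the norms are Euclidean or spectral. The covariances themselves depend on \<open>\<^bold>K\<close>
  quadratically, but the problem is written in terms of the factors \<open>P\<^sub>k\<^sup>1\<^sup>/\<^sup>2\<close> and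
  \<open>P\<^sub>u\<^sub>k\<^sup>1\<^sup>/\<^sup>2\<close>, and these are affine in \<open>\<^bold>K\<close>, because \<open>\<^bold>S\<^sup>1\<^sup>/\<^sup>2\<close> and the estimation
  error covariances are data and do not vary with the decision variables. A norm is convex, and so
  is its composite with an affine map (\<open>convex_on_compose_affine\<close>, \<open>convex_on_spectral_norm\<close>).

  Convexity of the sum then hinges on \<open>m \<ge> 0\<close>, which is where the risk levels enter. The
  chi-squared distribution lives on the nonnegative reals, so its quantiles at levels in \<open>(0, 1)\<close>
  are nonnegative (\<open>m_chi_nonneg\<close>). By symmetry, the quantiles of the standard normal distribution
  at levels in \<open>(1/2, 1)\<close> are nonnegative (\<open>m_normal_nonneg\<close>); this applies because the
  individual risks are positive with sum at most \<open>\<epsilon>\<^sub>x < 1/2\<close>, hence each of them is below \<open>1/2\<close>.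
  In the continuous problem the stage costs are moreover weighted by the positive step lengths.
\<close>

section \<open>Nonnegativity of the quantiles\<close>

text \<open>The condition \<open>p < 1\<close> makes the set of all \<open>x\<close> with \<open>p \<le> cdf M x\<close> nonempty, since the
  distribution function tends to \<open>1\<close>; the infimum of the empty set of reals would be an
  unspecified value.\<close>

lemma quantile_nonneg:
  assumes M: "real_distribution M" and "p < 1" and below: "\<And>x. x < 0 \<Longrightarrow> cdf M x < p"
  shows "0 \<le> quantile M p"
  unfolding quantile_def
proof (rule cInf_greatest)
  interpret real_distribution M by (rule M)
  have "eventually (\<lambda>x. p < cdf M x) at_top"
    using order_tendstoD(1)[OF cdf_lim_at_top_prob \<open>p < 1\<close>] .
  then obtain x where "p < cdf M x"
    using eventually_happens'[OF trivial_limit_at_top_linorder] by blast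
  then show "{x. p \<le> cdf M x} \<noteq> {}"
    by (auto intro: less_imp_le)
  show "0 \<le> x" if "x \<in> {x. p \<le> cdf M x}" for x
    using that below[of x] by (force simp: not_le)
qed

text \<open>The density is even, so the reflection \<open>y \<mapsto> - y\<close> maps one tail to the other.\<close>

lemma std_normal_symmetric:
  "emeasure std_normal_distribution {..x} = emeasure std_normal_distribution {- x..}"
proof -
  have "emeasure std_normal_distribution {..x} =
      (\<integral>\<^sup>+y. ennreal (std_normal_density y) * indicator {..x} y \<partial>lborel)"
    by (simp add: emeasure_density)
  also have "\<dots> = (\<integral>\<^sup>+y. ennreal (std_normal_density (- y)) * indicator {..x} (- y) \<partial>lborel)"
    by (subst nn_integral_real_affine[where c = "-1" and t = 0]) auto
  also have "\<dots> = (\<integral>\<^sup>+y. ennreal (std_normal_density y) * indicator {- x..} y \<partial>lborel)"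
    by (intro nn_integral_cong) (auto simp: std_normal_density_def split: split_indicator)
  also have "\<dots> = emeasure std_normal_distribution {- x..}"
    by (simp add: emeasure_density)
  finally show ?thesis .
qed

text \<open>The two tails beyond \<open>x < 0\<close> and \<open>- x\<close> are disjoint and equally likely.\<close>

lemma cdf_std_normal_le_half:
  assumes "x < 0"
  shows "cdf std_normal_distribution x \<le> 1 / 2"
proof -
  interpret real_distribution std_normal_distribution by (rule real_dist_normal_dist)
  have "2 * cdf std_normal_distribution x = prob {..x} + prob {- x..}"
    by (simp add: cdf_def measure_def std_normal_symmetric)
  also have "\<dots> = prob ({..x} \<union> {- x..})"
    using assms by (intro finite_measure_Union[symmetric]) auto
  also have "\<dots> \<le> 1"
    by (rule prob_le_1)
  finally show ?thesis by simp
qed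

lemma m_normal_nonneg:
  assumes "0 < \<epsilon>" "\<epsilon> < 1 / 2"
  shows "0 \<le> m_normal \<epsilon>"
  unfolding m_normal_def using assms
  by (intro quantile_nonneg real_dist_normal_dist)
    (auto intro: le_less_trans[OF cdf_std_normal_le_half])

lemma real_distribution_chi_squared: "real_distribution (chi_squared_distribution n)"
proof -
  interpret real_distribution std_normal_distribution by (rule real_dist_normal_dist)
  interpret product_prob_space "\<lambda>_::nat. std_normal_distribution" "{..<n}" ..
  show ?thesis
    unfolding chi_squared_distribution_def
    by (intro real_distribution_distr) measurable
qed

text \<open>A sum of squares never falls below \<open>0\<close>.\<close>

lemma cdf_chi_squared_neg:
  assumes "x < 0"
  shows "cdf (chi_squared_distribution n) x = 0"
proof -
  have "\<not> (\<Sum>i<n. (z i)\<^sup>2) \<le> x" for z :: "nat \<Rightarrow> real"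
    using assms sum_nonneg[of "{..<n}" "\<lambda>i. (z i)\<^sup>2"] by (simp add: not_le)
  then show ?thesis
    unfolding cdf_def chi_squared_distribution_def
    by (subst measure_distr) (auto simp: vimage_def)
qed

lemma m_chi_nonneg:
  assumes "0 < \<epsilon>" "\<epsilon> < 1"
  shows "0 \<le> m_chi \<epsilon> n"
  unfolding m_chi_def using assms
  by (intro real_sqrt_ge_zero quantile_nonneg real_distribution_chi_squared)
    (auto simp: cdf_chi_squared_neg)


section \<open>Affine maps\<close>

lemma affine_map_on_const: "affine_map_on X (\<lambda>_. c)"
  unfolding affine_map_on_def by (intro exI[of _ "\<lambda>_. 0"] exI[of _ c]) (simp add: linear_zero)

lemma affine_map_on_linear: "linear f \<Longrightarrow> affine_map_on X f"
  unfolding affine_map_on_def by (intro exI[of _ f] exI[of _ 0]) simp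

lemma affine_map_on_add:
  assumes "affine_map_on X f" "affine_map_on X g"
  shows "affine_map_on X (\<lambda>v. f v + g v)"
proof -
  obtain f' a where f: "linear f'" "\<forall>v\<in>X. f v = f' v + a"
    using assms(1) unfolding affine_map_on_def by blast
  obtain g' b where g: "linear g'" "\<forall>v\<in>X. g v = g' v + b"
    using assms(2) unfolding affine_map_on_def by blast
  show ?thesis
    unfolding affine_map_on_def using f g
    by (intro exI[of _ "\<lambda>v. f' v + g' v"] exI[of _ "a + b"]) (auto intro: linear_compose_add)
qed

lemma affine_map_on_compose_linear:
  assumes "linear g" "affine_map_on X f"
  shows "affine_map_on X (\<lambda>v. g (f v))"
proof -
  obtain f' a where f: "linear f'" "\<forall>v\<in>X. f v = f' v + a"
    using assms(2) unfolding affine_map_on_def by blast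
  show ?thesis
    unfolding affine_map_on_def using f assms(1)
    by (intro exI[of _ "\<lambda>v. g (f' v)"] exI[of _ "g a"])
      (auto simp: linear_add dest: linear_compose[unfolded o_def])
qed

lemma affine_map_on_diff_const: "affine_map_on X f \<Longrightarrow> affine_map_on X (\<lambda>v. f v - c)"
  using affine_map_on_add[OF _ affine_map_on_const[of X "- c"]] by simp

lemma linear_matrix_mult_right: "linear (\<lambda>M. M ** (R :: real^'c^'b))"
  by (rule linearI)
    (simp_all add: matrix_matrix_mult_def vec_eq_iff sum.distrib sum_distrib_left algebra_simps)

lemma linear_matrix_mult_left: "linear (\<lambda>M. (R :: real^'b^'a) ** M)"
  by (rule linearI)
    (simp_all add: matrix_matrix_mult_def vec_eq_iff sum.distrib sum_distrib_left algebra_simps)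

lemma linear_vector_matrix_mult: "linear (\<lambda>M. (a :: real^'a) v* M)"
  by (rule linearI)
    (simp_all add: vector_matrix_mult_def vec_eq_iff sum.distrib sum_distrib_left algebra_simps)

lemma linear_hcat_zero: "linear (\<lambda>M. hcat M (0 :: real^'c^'a))"
  by (rule linearI) (simp_all add: hcat_def vec_eq_iff split: sum.split)

text \<open>Appending a constant block is affine, and in general not linear: it is the linear padding
  with a zero block followed by a translation.\<close>

lemma affine_map_on_hcat_const:
  assumes "affine_map_on X f"
  shows "affine_map_on X (\<lambda>v. hcat (f v) R)"
proof -
  have "hcat (f v) R = hcat (f v) 0 + hcat 0 R" for v
    by (simp add: hcat_def vec_eq_iff split: sum.split)
  then show ?thesis
    by (simp add: affine_map_on_add affine_map_on_const
        affine_map_on_compose_linear[OF linear_hcat_zero assms])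
qed

lemmas affine_intros =
  affine_map_on_const affine_map_on_add affine_map_on_diff_const affine_map_on_hcat_const
  affine_map_on_compose_linear[OF linear_matrix_mult_right]
  affine_map_on_compose_linear[OF linear_matrix_mult_left]
  affine_map_on_compose_linear[OF matrix_vector_mul_linear]
  affine_map_on_linear[OF linear_fst] affine_map_on_linear[OF linear_snd]


section \<open>Convexity of norms of affine maps\<close>

lemma convex_on_compose_affine:
  assumes \<phi>: "convex_on UNIV \<phi>" and h: "affine_map_on X h" and X: "convex X"
  shows "convex_on X (\<lambda>v. \<phi> (h v))"
  unfolding convex_on_def
proof (intro conjI ballI allI impI)
  fix x y and s t :: real
  assume xy: "x \<in> X" "y \<in> X" and st: "0 \<le> s" "0 \<le> t" "s + t = 1"
  obtain f c where f: "linear f" and h_eq: "\<And>v. v \<in> X \<Longrightarrow> h v = f v + c"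
    using h unfolding affine_map_on_def by blast
  have "s *\<^sub>R x + t *\<^sub>R y \<in> X"
    using convexD[OF X xy st] .
  then have "h (s *\<^sub>R x + t *\<^sub>R y) = s *\<^sub>R f x + t *\<^sub>R f y + (s + t) *\<^sub>R c"
    using st by (simp add: h_eq linear_add[OF f] linear_scale[OF f])
  also have "\<dots> = s *\<^sub>R h x + t *\<^sub>R h y"
    using xy by (simp add: h_eq algebra_simps)
  finally show "\<phi> (h (s *\<^sub>R x + t *\<^sub>R y)) \<le> s * \<phi> (h x) + t * \<phi> (h y)"
    using \<phi> st by (simp add: convex_on_def)
qed (rule X)

lemma convex_on_norm: "convex_on UNIV (norm :: 'a::real_normed_vector \<Rightarrow> real)"
  using convex_on_dist[of UNIV "0 :: 'a"] by simp

text \<open>The spectral norm is an operator norm, hence subadditive and absolutely homogeneous.\<close>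

lemma convex_on_spectral_norm: "convex_on UNIV (spectral_norm :: real^'b^'a \<Rightarrow> real)"
  unfolding convex_on_def
proof (intro conjI ballI allI impI)
  fix M M' :: "real^'b^'a" and s t :: real
  assume st: "0 \<le> s" "0 \<le> t"
  have "(*v) (s *\<^sub>R M + t *\<^sub>R M') = (\<lambda>v. s *\<^sub>R (M *v v) + t *\<^sub>R (M' *v v))"
    by (simp add: fun_eq_iff matrix_vector_mult_add_rdistrib scaleR_matrix_vector_assoc)
  then have "spectral_norm (s *\<^sub>R M + t *\<^sub>R M') = onorm (\<lambda>v. s *\<^sub>R (M *v v) + t *\<^sub>R (M' *v v))"
    by (simp add: spectral_norm_def)
  also have "\<dots> \<le> onorm (\<lambda>v. s *\<^sub>R (M *v v)) + onorm (\<lambda>v. t *\<^sub>R (M' *v v))"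
    by (intro onorm_triangle bounded_linear_const_scaleR matrix_vector_mul_bounded_linear)
  also have "\<dots> = s * spectral_norm M + t * spectral_norm M'"
    using st by (simp add: spectral_norm_def onorm_scaleR)
  finally show "spectral_norm (s *\<^sub>R M + t *\<^sub>R M') \<le> s * spectral_norm M + t * spectral_norm M'" .
qed simp

text \<open>The common shape of the stage costs and of the deterministic surrogates for the chance
  constraints on norms: \<open>h\<close> is the mean, \<open>M\<close> a factor of the covariance.\<close>

lemma convex_on_norm_plus_spectral_norm:
  assumes "convex X" "0 \<le> m" "affine_map_on X h" "affine_map_on X M"
  shows "convex_on X (\<lambda>v. norm (h v) + m * spectral_norm (M v))"
  using assms
  by (intro convex_on_add convex_on_cmul convex_on_compose_affine[OF convex_on_norm]
      convex_on_compose_affine[OF convex_on_spectral_norm])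

lemma convex_on_diff_const: "convex_on X f \<Longrightarrow> convex_on X (\<lambda>v. f v - d)"
  using convex_on_add[of X f "\<lambda>_. - d"] by (simp add: convex_on_const convex_on_imp_convex)

lemma convex_on_finite_sum:
  assumes "convex X" "\<And>i. i \<in> I \<Longrightarrow> convex_on X (f i)"
  shows "convex_on X (\<lambda>v. \<Sum>i\<in>I. f i v)"
  using assms(2)
  by (induction I rule: infinite_finite_induct) (simp_all add: convex_on_const assms(1) convex_on_add)


section \<open>The covariance steering problem\<close>

lemma subspace_gain_space:
  "subspace (gain_space :: (real^('n::finite option fin \<times> 'x::finite)^('n fin \<times> 'u::finite)) set)"
  unfolding subspace_def
proof (intro conjI ballI allI)
  have "blkdiag (\<lambda>_. 0) = 0"
    by (simp add: blkdiag_def block_mat_def vec_eq_iff)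
  then show "0 \<in> gain_space"
    unfolding gain_space_def by (metis rangeI)
next
  fix K K' :: "real^('n::finite option fin \<times> 'x::finite)^('n fin \<times> 'u::finite)"
  assume "K \<in> gain_space" "K' \<in> gain_space"
  then obtain M M' where "K = blkdiag M" "K' = blkdiag M'"
    unfolding gain_space_def by blast
  then have "K + K' = blkdiag (\<lambda>k. M k + M' k)"
    by (simp add: blkdiag_def block_mat_def vec_eq_iff)
  then show "K + K' \<in> gain_space"
    unfolding gain_space_def by simp
next
  fix s and K :: "real^('n::finite option fin \<times> 'x::finite)^('n fin \<times> 'u::finite)"
  assume "K \<in> gain_space"
  then obtain M where "K = blkdiag M"
    unfolding gain_space_def by blast
  then have "s *\<^sub>R K = blkdiag (\<lambda>k. s *\<^sub>R M k)"
    by (simp add: blkdiag_def block_mat_def vec_eq_iff)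
  then show "s *\<^sub>R K \<in> gain_space"
    unfolding gain_space_def by simp
qed

theorem theorem1:
  fixes A :: "nat \<Rightarrow> real^'nx::{finite,linorder}^'nx::{finite,linorder}"
    and B :: "nat \<Rightarrow> real^'nu^'nx::{finite,linorder}"
    and c :: "nat \<Rightarrow> real^'nx::{finite,linorder}"
    and Gexe :: "nat \<Rightarrow> real^'ge^'nx::{finite,linorder}"
    and G :: "nat \<Rightarrow> real^'gw^'nx::{finite,linorder}"
    and C :: "nat \<Rightarrow> real^'nx::{finite,linorder}^'ny::{finite,linorder}"
    and D :: "nat \<Rightarrow> real^'ny::{finite,linorder}^'ny::{finite,linorder}"
    and x0 :: "real^'nx::{finite,linorder}"
    and Phat0 Phat0_half :: "real^'nx::{finite,linorder}^'nx::{finite,linorder}"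
    and Ptm Pt Pt_half :: "nat \<Rightarrow> real^'nx::{finite,linorder}^'nx::{finite,linorder}"
    and Py :: "nat \<Rightarrow> real^'ny::{finite,linorder}^'ny::{finite,linorder}"
    and L :: "nat \<Rightarrow> real^'ny::{finite,linorder}^'nx::{finite,linorder}"
    and PY_half :: "real^('n::finite option fin \<times> 'ny)^('n option fin \<times> 'ny)"
    and S_half :: "real^('nx + 'n option fin \<times> 'ny)^('n option fin \<times> 'nx)"
    and N :: nat
    and J :: "'j set" and a :: "'j \<Rightarrow> real^'nx::{finite,linorder}" and b eps_xj :: "'j \<Rightarrow> real"
    and eps_x eps_u d_max u_max du_max :: real
    and H :: "real^'nx::{finite,linorder}^'nh"
    and xref :: "nat \<Rightarrow> real^'nx::{finite,linorder}"
    and dt :: "nat \<Rightarrow> real"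
    and x_f :: "real^'nx::{finite,linorder}"
    and P_f Pf_half :: "real^'nx::{finite,linorder}^'nx::{finite,linorder}"
  assumes N: "N = CARD('n)"
    and Phat0: "psd Phat0" "lower_factor (<) Phat0 Phat0_half"
    and Ptm0: "psd (Ptm 0)"
    and Py: "\<And>k. k \<le> N \<Longrightarrow>
        Py k = C k ** Ptm k ** transpose (C k) + D k ** transpose (D k)"
    and Py_inv: "\<And>k. k \<le> N \<Longrightarrow> invertible (Py k)"
    and L: "\<And>k. k \<le> N \<Longrightarrow> L k = Ptm k ** transpose (C k) ** matrix_inv (Py k)"
    and Pt: "\<And>k. k \<le> N \<Longrightarrow>
        Pt k = (mat 1 - L k ** C k) ** Ptm k ** transpose (mat 1 - L k ** C k)
               + L k ** D k ** transpose (D k) ** transpose (L k)"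
    and Ptm: "\<And>k. 1 \<le> k \<Longrightarrow> k \<le> N \<Longrightarrow>
        Ptm k = A (k - 1) ** Pt (k - 1) ** transpose (A (k - 1))
                + Gexe (k - 1) ** transpose (Gexe (k - 1)) + G (k - 1) ** transpose (G (k - 1))"
    and Pt_half: "\<And>k. k \<le> N \<Longrightarrow> lower_factor (<) (Pt k) (Pt_half k)"
    and PY_half: "lower_factor block_less (blkdiag Py) PY_half"
    and S_half: "S_half = hcat (bigA A ** Phat0_half) (bigL A L ** PY_half)"
    and J: "finite J"
    and eps_x: "0 < eps_x" "eps_x < 1/2"
    and eps_u: "0 < eps_u" "eps_u < 1"
    and eps_xj: "\<And>j. j \<in> J \<Longrightarrow> 0 < eps_xj j" "(\<Sum>j\<in>J. eps_xj j) \<le> eps_x"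
    and maxima: "0 < d_max" "0 < u_max" "0 < du_max"
    and dt: "\<And>k. k < N \<Longrightarrow> 0 < dt k"
    and P_f: "transpose P_f = P_f" "pos_def (P_f - Pt N)"
    and Pf_half: "lower_factor (<) (P_f - Pt N) Pf_half"
  shows
    "let X = (\<lambda>U :: real^('n fin \<times> 'nu). bigA A *v x0 + bigB A B *v U + bigC A c);
         xbar = (\<lambda>k U. E_block k *v X U);
         ubar = (\<lambda>k (U :: real^('n fin \<times> 'nu)). E_block k *v U);
         P_half = (\<lambda>k (K :: real^('n option fin \<times> 'nx)^('n fin \<times> 'nu)).
            hcat (E_block k ** (mat 1 + bigB A B ** K) ** S_half) (Pt_half k));
         Pu_half = (\<lambda>k (K :: real^('n option fin \<times> 'nx)^('n fin \<times> 'nu)).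
            E_block k ** K ** S_half);
         cost = (\<lambda>k U K. norm (ubar k U) + m_chi 0.01 CARD('nu) * spectral_norm (Pu_half k K));
         J_impulsive = (\<lambda>(U, K). \<Sum>k<N. cost k U K);
         J_continuous = (\<lambda>(U, K). \<Sum>k<N. cost k U K * dt k);
         dE = (\<lambda>k. E_block (k + 1) - E_block k :: real^('n fin \<times> 'nu)^'nu);
         ineqs =
           {\<lambda>(U, K). a j \<bullet> xbar k U + b j + m_normal (eps_xj j) * norm (a j v* P_half k K)
              | j k. j \<in> J \<and> k \<le> N} \<union>
           {\<lambda>(U, K). norm (H *v (xbar k U - xref k))
                + m_chi eps_x CARD('nh) * spectral_norm (H ** P_half k K) - d_max
              | k. k \<le> N} \<union>
           {\<lambda>(U, K). norm (ubar k U) + m_chi eps_u CARD('nu) * spectral_norm (Pu_half k K) - u_max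
              | k. k < N} \<union>
           {\<lambda>(U, K). norm (dE k *v U)
                + m_chi eps_u CARD('nu) * spectral_norm (dE k ** K ** S_half) - du_max
              | k. k + 1 < N} \<union>
           {\<lambda>(U, K). spectral_norm
                (matrix_inv Pf_half ** E_block N ** (mat 1 + bigB A B ** K) ** S_half) - 1};
         eqs = {\<lambda>(U, K). E_block N *v X U - x_f};
         problem = (\<lambda>J_ub. \<lparr>decisions = UNIV \<times> gain_space, objective = J_ub,
                            inequalities = ineqs, equalities = eqs\<rparr>)
     in convex_opt_problem (problem J_impulsive) \<and> convex_opt_problem (problem J_continuous)"
proof -
  define Dec where "Dec = (UNIV :: (real^('n fin \<times> 'nu)) set) \<times>
    (gain_space :: (real^('n option fin \<times> 'nx::{finite,linorder})^('n fin \<times> 'nu)) set)"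
  define xbar where "xbar k U = (E_block k :: real^('n option fin \<times> 'nx::{finite,linorder})^'nx::{finite,linorder}) *v
    (bigA A *v x0 + bigB A B *v U + bigC A c)" for k and U :: "real^('n fin \<times> 'nu)"
  define P_half where "P_half k K =
    hcat (E_block k ** (mat 1 + bigB A B ** K) ** S_half) (Pt_half k)"
    for k and K :: "real^('n option fin \<times> 'nx::{finite,linorder})^('n fin \<times> 'nu)"
  define cost where "cost k = (\<lambda>(U :: real^('n fin \<times> 'nu),
      K :: real^('n option fin \<times> 'nx::{finite,linorder})^('n fin \<times> 'nu)).
    norm (E_block k *v U) + m_chi 0.01 CARD('nu) * spectral_norm (E_block k ** K ** S_half))" for k

  have subspace: "subspace Dec"
    unfolding Dec_def by (intro subspace_Times subspace_UNIV subspace_gain_space)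
  then have Dec: "convex Dec"
    by (rule subspace_imp_convex)
  have xbar: "affine_map_on Dec (\<lambda>v. xbar k (fst v))" for k
    unfolding xbar_def by (intro affine_intros)
  have P_half: "affine_map_on Dec (\<lambda>v. P_half k (snd v))" for k
    unfolding P_half_def by (intro affine_intros)

  \<comment> \<open>The other risks being positive, a single one is at most the sum, hence at most \<open>eps_x\<close>.\<close>
  have small_risk: "eps_xj j < 1 / 2" if "j \<in> J" for j
    using member_le_sum[of j J eps_xj] eps_xj eps_x J that by fastforce
  \<comment> \<open>The mean part is an affine real function, that is, the identity composed with an affine map.\<close>
  have halfspace: "convex_on Dec (\<lambda>(U, K).
      a j \<bullet> xbar k U + b j + m_normal (eps_xj j) * norm (a j v* P_half k K))" if "j \<in> J" for j k
    unfolding case_prod_unfold using Dec that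
    by (intro convex_on_add convex_on_cmul m_normal_nonneg eps_xj small_risk
        convex_on_compose_affine[OF convex_on_norm]
        convex_on_compose_affine[OF convex_on_ident[THEN iffD2, OF convex_UNIV]]
        affine_map_on_compose_linear[OF linear_vector_matrix_mult]
        affine_map_on_compose_linear[OF bounded_linear.linear[OF bounded_linear_inner_right]]
        convex_on_const[THEN iffD2] xbar P_half)
  have tracking: "convex_on Dec (\<lambda>(U, K). norm (H *v (xbar k U - xref k))
      + m_chi eps_x CARD('nh) * spectral_norm (H ** P_half k K) - d_max)" for k
    unfolding case_prod_unfold using eps_x
    by (intro convex_on_diff_const convex_on_norm_plus_spectral_norm Dec m_chi_nonneg
        affine_intros xbar P_half) auto
  have control: "convex_on Dec (\<lambda>(U, K). norm ((E_block k :: real^('n fin \<times> 'nu)^'nu) *v U)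
      + m_chi eps_u CARD('nu) * spectral_norm (E_block k ** K ** S_half) - u_max)" for k
    unfolding case_prod_unfold using eps_u
    by (intro convex_on_diff_const convex_on_norm_plus_spectral_norm Dec m_chi_nonneg affine_intros)
  have control_rate: "convex_on Dec (\<lambda>(U, K).
      norm ((E_block (k + 1) - E_block k :: real^('n fin \<times> 'nu)^'nu) *v U)
      + m_chi eps_u CARD('nu) * spectral_norm ((E_block (k + 1) - E_block k) ** K ** S_half)
      - du_max)" for k
    unfolding case_prod_unfold using eps_u
    by (intro convex_on_diff_const convex_on_norm_plus_spectral_norm Dec m_chi_nonneg affine_intros)
  have terminal_covariance: "convex_on Dec (\<lambda>(U, K). spectral_norm
      (matrix_inv Pf_half ** E_block N ** (mat 1 + bigB A B ** K) ** S_half) - 1)"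
    unfolding case_prod_unfold
    by (intro convex_on_diff_const convex_on_compose_affine[OF convex_on_spectral_norm] Dec
        affine_intros)
  have terminal_mean: "affine_map_on Dec (\<lambda>(U, K). xbar N U - x_f)"
    unfolding case_prod_unfold by (intro affine_intros xbar)

  have cost: "convex_on Dec (cost k)" for k
    unfolding cost_def case_prod_unfold
    by (intro convex_on_norm_plus_spectral_norm Dec m_chi_nonneg affine_intros) auto
  have impulsive: "convex_on Dec (\<lambda>(U, K). \<Sum>k<N. cost k (U, K))"
    using cost by (simp add: case_prod_unfold convex_on_finite_sum Dec)
  have "convex_on Dec (\<lambda>v. dt k * cost k v)" if "k < N" for k
    using dt[OF that] cost by (intro convex_on_cmul) auto
  then have continuous: "convex_on Dec (\<lambda>(U, K). \<Sum>k<N. cost k (U, K) * dt k)"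
    unfolding case_prod_unfold by (intro convex_on_finite_sum Dec) (simp add: mult.commute)

  have finite_stages: "finite {g k | k. k \<le> N}" "finite {g k | k. k < N}"
      "finite {g k | k. k + 1 < N}" for g :: "nat \<Rightarrow> _ \<Rightarrow> real"
    by (auto intro!: finite_image_set intro: finite_subset[of _ "{..N}"])
  have finite_halfspaces: "finite {g j k | j k. j \<in> J \<and> k \<le> N}" for g :: "_ \<Rightarrow> nat \<Rightarrow> _ \<Rightarrow> real"
    using J by (intro finite_image_set2) auto

  \<comment> \<open>The deleted rules would rewrite \<open>k + 1\<close> to \<open>Suc k\<close> and make \<open>control_rate\<close> inapplicable.\<close>
  show ?thesis
    unfolding Let_def convex_opt_problem_def opt_problem.select_convs
      Dec_def[symmetric] xbar_def[symmetric] P_half_def[symmetric]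
    using subspace impulsive continuous
    by (auto simp: finite_stages finite_halfspaces cost_def simp del: One_nat_def add_Suc_right
        intro: halfspace tracking control control_rate terminal_covariance terminal_mean)
qed

end
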